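(* Let $(X,r)$ be a solution and let $k$ be a positive integer. Then the subset $kX=\{kx\mid x\in X\}\subseteq M(X,r)$ is a subsolution of $(M(X,r),r_M)$; that is, $r_M$ restricts to a map $r_k:kX\times kX\to kX\times kX$ and $(kX,r_k)$ is a solution.
   Context: "Solution" means finite bijective non-degenerate set-theoretic solution of the Yang--Baxter equation: a pair $(X,r)$ with $X$ a non-empty finite set and $r:X\times X\to X\times X$, $r(x,y)=(\lambda_x(y),\rho_y(x))$, a bijection such that $(r\times \mathrm{id}_X)(\mathrm{id}_X\times r)(r\times \mathrm{id}_X)=(\mathrm{id}_X\times r)(r\times \mathrm{id}_X)(\mathrm{id}_X\times r)$ and all maps $\lambda_x,\rho_x:X\to X$ are bijective. Put $\sigma_y(x)=\lambda_y(\rho_{\lambda_x^{-1}(y)}(x))$. The Yang--Baxter monoid is $M(X,r)=(M,\circ)=\langle x\in X\mid x\circ y=\lambda_x(y)\circ\rho_y(x)\rangle$, and the derived monoid is $A(X,r)=\langle x\in X\mid x\oplus y=y\oplus\sigma_y(x)\rangle$; $X$ embeds in both as the generating set. The map $r$ extends uniquely to a (not necessarily finite) set-theoretic solution $r_M(a,b)=(\lambda_a(b),\rho_b(a))$ on $M$ with $a\circ b=\lambda_a(b)\circ\rho_b(a)$, $\lambda_{a\circ b}=\lambda_a\lambda_b$, $\rho_{a\circ b}=\rho_b\rho_a$, $\lambda_a(b\circ c)=\lambda_a(b)\circ\lambda_{\rho_b(a)}(c)$ and $\rho_c(a\circ b)=\rho_{\lambda_b(c)}(a)\circ\rho_c(b)$.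 Moreover $\lambda$ induces an action of $M(X,r)$ on $A(X,r)$ by automorphisms, and the identity of $X$ extends to a bijective 1-cocycle $\pi:M(X,r)\to A(X,r)$ for this action; one sets $a+b=\pi^{-1}(\pi(a)\oplus\pi(b))$ on $M$, so that $(M,+)\cong A(X,r)$ and $a\circ b=a+\lambda_a(b)$. For $x\in X$, $kx=x+\cdots+x$ ($k$ summands) in $(M,+)$. *)

theory Defs
  imports "HOL-Algebra.Group"
begin

section \<open>Solutions of the Yang--Baxter equation\<close>

text \<open>A map \<open>r\<close> on \<open>X \<times> X\<close> is written \<open>r (x, y) = (\<lambda>\<^sub>x(y), \<rho>\<^sub>y(x))\<close>. Only the values of
  \<open>r\<close> on \<open>X \<times> X\<close> matter.\<close>

definition lam :: "('a \<times> 'a \<Rightarrow> 'a \<times> 'a) \<Rightarrow> 'a \<Rightarrow> 'a \<Rightarrow> 'a"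
  where "lam r x y = fst (r (x, y))"

definition rho :: "('a \<times> 'a \<Rightarrow> 'a \<times> 'a) \<Rightarrow> 'a \<Rightarrow> 'a \<Rightarrow> 'a"
  where "rho r y x = snd (r (x, y))"

definition yb12 :: "('a \<times> 'a \<Rightarrow> 'a \<times> 'a) \<Rightarrow> 'a \<times> 'a \<times> 'a \<Rightarrow> 'a \<times> 'a \<times> 'a"
  where "yb12 r = (\<lambda>(x, y, z). case r (x, y) of (u, v) \<Rightarrow> (u, v, z))"

definition yb23 :: "('a \<times> 'a \<Rightarrow> 'a \<times> 'a) \<Rightarrow> 'a \<times> 'a \<times> 'a \<Rightarrow> 'a \<times> 'a \<times> 'a"
  where "yb23 r = (\<lambda>(x, y, z). (x, r (y, z)))"

definition yang_baxter :: "'a set \<Rightarrow> ('a \<times> 'a \<Rightarrow> 'a \<times> 'a) \<Rightarrow> bool"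
  where "yang_baxter X r \<longleftrightarrow>
    (\<forall>t \<in> X \<times> X \<times> X. (yb12 r \<circ> yb23 r \<circ> yb12 r) t = (yb23 r \<circ> yb12 r \<circ> yb23 r) t)"

definition yb_solution :: "'a set \<Rightarrow> ('a \<times> 'a \<Rightarrow> 'a \<times> 'a) \<Rightarrow> bool"
  where "yb_solution X r \<longleftrightarrow>
    finite X \<and> X \<noteq> {} \<and> bij_betw r (X \<times> X) (X \<times> X) \<and> yang_baxter X r \<and>
    (\<forall>x \<in> X. bij_betw (lam r x) X X) \<and> (\<forall>y \<in> X. bij_betw (rho r y) X X)"

text \<open>\<open>Y\<close> is a subsolution of \<open>(S, r)\<close>; the ambient \<open>S\<close> may be infinite.\<close>

definition subsolution :: "'a set \<Rightarrow> 'a set \<Rightarrow> ('a \<times> 'a \<Rightarrow> 'a \<times> 'a) \<Rightarrow> bool"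
  where "subsolution Y S r \<longleftrightarrow>
    Y \<subseteq> S \<and> r \<in> Y \<times> Y \<rightarrow> Y \<times> Y \<and> yb_solution Y (restrict r (Y \<times> Y))"

definition sigma :: "'a set \<Rightarrow> ('a \<times> 'a \<Rightarrow> 'a \<times> 'a) \<Rightarrow> 'a \<Rightarrow> 'a \<Rightarrow> 'a"
  where "sigma X r y x = lam r y (rho r (inv_into X (lam r x) y) x)"


section \<open>Monoids given by generators and relations\<close>

text \<open>The congruence on the free monoid \<open>lists X\<close> generated by the pairs in \<open>R\<close>.\<close>

inductive_set word_cong :: "'a set \<Rightarrow> ('a list \<times> 'a list) set \<Rightarrow> ('a list \<times> 'a list) set"
  for X R where
  rel: "(u, v) \<in> R \<Longrightarrow> u \<in> lists X \<Longrightarrow> v \<in> lists X \<Longrightarrow> (u, v) \<in> word_cong X R"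
| refl: "u \<in> lists X \<Longrightarrow> (u, u) \<in> word_cong X R"
| sym: "(u, v) \<in> word_cong X R \<Longrightarrow> (v, u) \<in> word_cong X R"
| trans: "(u, v) \<in> word_cong X R \<Longrightarrow> (v, w) \<in> word_cong X R \<Longrightarrow> (u, w) \<in> word_cong X R"
| append: "(u, v) \<in> word_cong X R \<Longrightarrow> (u', v') \<in> word_cong X R \<Longrightarrow>
    (u @ u', v @ v') \<in> word_cong X R"

definition presented_monoid :: "'a set \<Rightarrow> ('a list \<times> 'a list) set \<Rightarrow> 'a list set monoid"
  where "presented_monoid X R =
    \<lparr>carrier = lists X // word_cong X R,
     mult = (\<lambda>A B. \<Union>a \<in> A. \<Union>b \<in> B. word_cong X R `` {a @ b}),
     one = word_cong X R `` {[]}\<rparr>"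

definition yb_rel :: "'a set \<Rightarrow> ('a \<times> 'a \<Rightarrow> 'a \<times> 'a) \<Rightarrow> ('a list \<times> 'a list) set"
  where "yb_rel X r = {([x, y], [lam r x y, rho r y x]) | x y. x \<in> X \<and> y \<in> X}"

definition derived_rel :: "'a set \<Rightarrow> ('a \<times> 'a \<Rightarrow> 'a \<times> 'a) \<Rightarrow> ('a list \<times> 'a list) set"
  where "derived_rel X r = {([x, y], [y, sigma X r y x]) | x y. x \<in> X \<and> y \<in> X}"

abbreviation yb_cong :: "'a set \<Rightarrow> ('a \<times> 'a \<Rightarrow> 'a \<times> 'a) \<Rightarrow> ('a list \<times> 'a list) set"
  where "yb_cong X r \<equiv> word_cong X (yb_rel X r)"

abbreviation derived_cong :: "'a set \<Rightarrow> ('a \<times> 'a \<Rightarrow> 'a \<times> 'a) \<Rightarrow> ('a list \<times> 'a list) set"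
  where "derived_cong X r \<equiv> word_cong X (derived_rel X r)"

definition yb_monoid :: "'a set \<Rightarrow> ('a \<times> 'a \<Rightarrow> 'a \<times> 'a) \<Rightarrow> 'a list set monoid"
  where "yb_monoid X r = presented_monoid X (yb_rel X r)"

definition derived_monoid :: "'a set \<Rightarrow> ('a \<times> 'a \<Rightarrow> 'a \<times> 'a) \<Rightarrow> 'a list set monoid"
  where "derived_monoid X r = presented_monoid X (derived_rel X r)"

definition yb_gen :: "'a set \<Rightarrow> ('a \<times> 'a \<Rightarrow> 'a \<times> 'a) \<Rightarrow> 'a \<Rightarrow> 'a list set"
  where "yb_gen X r x = yb_cong X r `` {[x]}"

definition derived_gen :: "'a set \<Rightarrow> ('a \<times> 'a \<Rightarrow> 'a \<times> 'a) \<Rightarrow> 'a \<Rightarrow> 'a list set"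
  where "derived_gen X r x = derived_cong X r `` {[x]}"


section \<open>The extension of \<open>r\<close> to the Yang--Baxter monoid\<close>

text \<open>On words the extension is forced by
  \<open>\<lambda>\<^sub>a(b \<circ> c) = \<lambda>\<^sub>a(b) \<circ> \<lambda>\<^bsub>\<rho>\<^sub>b(a)\<^esub>(c)\<close>, \<open>\<rho>\<^bsub>a \<circ> b\<^esub> = \<rho>\<^sub>b \<rho>\<^sub>a\<close>,
  \<open>\<lambda>\<^bsub>a \<circ> b\<^esub> = \<lambda>\<^sub>a \<lambda>\<^sub>b\<close> and \<open>\<rho>\<^sub>c(a \<circ> b) = \<rho>\<^bsub>\<lambda>\<^sub>b(c)\<^esub>(a) \<circ> \<rho>\<^sub>c(b)\<close>.\<close>

primrec lam_letter :: "('a \<times> 'a \<Rightarrow> 'a \<times> 'a) \<Rightarrow> 'a \<Rightarrow> 'a list \<Rightarrow> 'a list" where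
  "lam_letter r x [] = []"
| "lam_letter r x (y # w) = lam r x y # lam_letter r (rho r y x) w"

primrec rho_letter :: "('a \<times> 'a \<Rightarrow> 'a \<times> 'a) \<Rightarrow> 'a list \<Rightarrow> 'a \<Rightarrow> 'a" where
  "rho_letter r [] x = x"
| "rho_letter r (y # w) x = rho_letter r w (rho r y x)"

primrec lam_word :: "('a \<times> 'a \<Rightarrow> 'a \<times> 'a) \<Rightarrow> 'a list \<Rightarrow> 'a list \<Rightarrow> 'a list" where
  "lam_word r [] w = w"
| "lam_word r (x # u) w = lam_letter r x (lam_word r u w)"

primrec rho_word :: "('a \<times> 'a \<Rightarrow> 'a \<times> 'a) \<Rightarrow> 'a list \<Rightarrow> 'a list \<Rightarrow> 'a list" where
  "rho_word r w [] = []"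
| "rho_word r w (x # u) = rho_letter r (lam_word r u w) x # rho_word r w u"

definition yb_ext ::
  "'a set \<Rightarrow> ('a \<times> 'a \<Rightarrow> 'a \<times> 'a) \<Rightarrow> 'a list set \<times> 'a list set \<Rightarrow> 'a list set \<times> 'a list set"
  where "yb_ext X r = (\<lambda>(A, B).
    (\<Union>a \<in> A. \<Union>b \<in> B. yb_cong X r `` {lam_word r a b},
     \<Union>a \<in> A. \<Union>b \<in> B. yb_cong X r `` {rho_word r b a}))"


section \<open>The additive structure\<close>

text \<open>The action of the Yang--Baxter monoid on the derived monoid is induced by letting a letter
  \<open>x\<close> act on a word by applying \<open>\<lambda>\<^sub>x\<close> to each letter; the cocycle is forced by
  \<open>\<pi>(x) = x\<close> and \<open>\<pi>(a \<circ> b) = \<pi>(a) \<oplus> \<lambda>\<^sub>a(\<pi>(b))\<close>.\<close>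

definition act_word :: "('a \<times> 'a \<Rightarrow> 'a \<times> 'a) \<Rightarrow> 'a list \<Rightarrow> 'a list \<Rightarrow> 'a list"
  where "act_word r u w = foldr (\<lambda>x. map (lam r x)) u w"

definition yb_act ::
  "'a set \<Rightarrow> ('a \<times> 'a \<Rightarrow> 'a \<times> 'a) \<Rightarrow> 'a list set \<Rightarrow> 'a list set \<Rightarrow> 'a list set"
  where "yb_act X r A B = (\<Union>a \<in> A. \<Union>b \<in> B. derived_cong X r `` {act_word r a b})"

primrec cocycle_word :: "('a \<times> 'a \<Rightarrow> 'a \<times> 'a) \<Rightarrow> 'a list \<Rightarrow> 'a list" where
  "cocycle_word r [] = []"
| "cocycle_word r (x # u) = x # act_word r [x] (cocycle_word r u)"

definition yb_cocycle :: "'a set \<Rightarrow> ('a \<times> 'a \<Rightarrow> 'a \<times> 'a) \<Rightarrow> 'a list set \<Rightarrow> 'a list set"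
  where "yb_cocycle X r A = (\<Union>a \<in> A. derived_cong X r `` {cocycle_word r a})"

text \<open>The monoid \<open>(M, +)\<close>, with \<open>+\<close> in the multiplication slot of the record; hence the
  multiple \<open>k a\<close> is the power \<open>a [^] k\<close> in this monoid.\<close>

definition yb_add_monoid :: "'a set \<Rightarrow> ('a \<times> 'a \<Rightarrow> 'a \<times> 'a) \<Rightarrow> 'a list set monoid"
  where "yb_add_monoid X r =
    \<lparr>carrier = carrier (yb_monoid X r),
     mult = (\<lambda>A B. inv_into (carrier (yb_monoid X r)) (yb_cocycle X r)
                (yb_cocycle X r A \<otimes>\<^bsub>derived_monoid X r\<^esub> yb_cocycle X r B)),
     one = \<one>\<^bsub>yb_monoid X r\<^esub>\<rparr>"

definition yb_multiples :: "'a set \<Rightarrow> ('a \<times> 'a \<Rightarrow> 'a \<times> 'a) \<Rightarrow> nat \<Rightarrow> 'a list set set"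
  where "yb_multiples X r k = (\<lambda>x. yb_gen X r x [^]\<^bsub>yb_add_monoid X r\<^esub> k) ` X"

section \<open>Well-definedness\<close>

subsection \<open>Presented monoids\<close>

lemma word_cong_lists: "(u, v) \<in> word_cong X R \<Longrightarrow> u \<in> lists X \<and> v \<in> lists X"
  by (induction rule: word_cong.induct) auto

lemma equiv_word_cong: "equiv (lists X) (word_cong X R)"
proof (rule equivI)
  show "word_cong X R \<subseteq> lists X \<times> lists X"
    by (rule subrelI) (blast dest: word_cong_lists)
  show "refl_on (lists X) (word_cong X R)"
    by (rule refl_onI) (rule word_cong.refl)
  show "sym (word_cong X R)"
    by (rule symI) (rule word_cong.sym)
  show "trans (word_cong X R)"
    by (rule transI) (rule word_cong.trans)
qed

lemma word_cong_class_eq_iff: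
  "u \<in> lists X \<Longrightarrow> v \<in> lists X \<Longrightarrow>
    word_cong X R `` {u} = word_cong X R `` {v} \<longleftrightarrow> (u, v) \<in> word_cong X R"
  by (rule eq_equiv_class_iff[OF equiv_word_cong])

lemma word_cong_UN2:
  assumes "u \<in> lists X" and "v \<in> lists X"
    and cong: "\<And>a b. (u, a) \<in> word_cong X R \<Longrightarrow> (v, b) \<in> word_cong X R \<Longrightarrow>
      (f u v, f a b) \<in> word_cong X S"
  shows "(\<Union>a \<in> word_cong X R `` {u}. \<Union>b \<in> word_cong X R `` {v}. word_cong X S `` {f a b})
    = word_cong X S `` {f u v}"
proof -
  have eq: "word_cong X S `` {f a b} = word_cong X S `` {f u v}"
    if "(u, a) \<in> word_cong X R" "(v, b) \<in> word_cong X R" for a b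
    using equiv_class_eq[OF equiv_word_cong cong[OF that]] by simp
  have "(\<Union>a \<in> word_cong X R `` {u}. \<Union>b \<in> word_cong X R `` {v}. word_cong X S `` {f a b})
    = (\<Union>a \<in> word_cong X R `` {u}. \<Union>b \<in> word_cong X R `` {v}. word_cong X S `` {f u v})"
    by (intro SUP_cong HOL.refl) (simp add: eq)
  also have "\<dots> = word_cong X S `` {f u v}"
  proof -
    have "u \<in> word_cong X R `` {u}" "v \<in> word_cong X R `` {v}"
      using assms(1,2) by (simp_all only: Image_singleton_iff word_cong.refl)
    then have "word_cong X R `` {u} \<noteq> {}" "word_cong X R `` {v} \<noteq> {}"
      by (metis empty_iff)+
    then show ?thesis by (simp only: UN_constant if_False)
  qed
  finally show ?thesis .
qed

lemma presented_mult:
  assumes "u \<in> lists X" and "v \<in> lists X"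
  shows "word_cong X R `` {u} \<otimes>\<^bsub>presented_monoid X R\<^esub> word_cong X R `` {v}
    = word_cong X R `` {u @ v}"
  unfolding presented_monoid_def
  by (simp add: word_cong_UN2[OF assms, where f = append] word_cong.append)

lemma presented_carrier: "carrier (presented_monoid X R) = lists X // word_cong X R"
  by (simp add: presented_monoid_def)

lemma presented_one: "\<one>\<^bsub>presented_monoid X R\<^esub> = word_cong X R `` {[]}"
  by (simp add: presented_monoid_def)

lemma presented_cases:
  assumes "A \<in> carrier (presented_monoid X R)"
  obtains u where "u \<in> lists X" "A = word_cong X R `` {u}"
  using assms unfolding presented_carrier by (elim quotientE)

lemma presented_class: "u \<in> lists X \<Longrightarrow> word_cong X R `` {u} \<in> carrier (presented_monoid X R)"
  unfolding presented_carrier by (rule quotientI)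

lemma presented_monoid: "monoid (presented_monoid X R)"
proof (rule monoidI)
  fix A B C
  assume "A \<in> carrier (presented_monoid X R)" "B \<in> carrier (presented_monoid X R)"
    "C \<in> carrier (presented_monoid X R)"
  then show "A \<otimes>\<^bsub>presented_monoid X R\<^esub> B \<otimes>\<^bsub>presented_monoid X R\<^esub> C
    = A \<otimes>\<^bsub>presented_monoid X R\<^esub> (B \<otimes>\<^bsub>presented_monoid X R\<^esub> C)"
    by (elim presented_cases) (simp add: presented_mult)
next
  fix A B
  assume "A \<in> carrier (presented_monoid X R)" "B \<in> carrier (presented_monoid X R)"
  then show "A \<otimes>\<^bsub>presented_monoid X R\<^esub> B \<in> carrier (presented_monoid X R)"
    by (elim presented_cases) (simp add: presented_mult presented_class)
next
  fix A
  assume A: "A \<in> carrier (presented_monoid X R)"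
  then show "\<one>\<^bsub>presented_monoid X R\<^esub> \<otimes>\<^bsub>presented_monoid X R\<^esub> A = A"
    by (elim presented_cases) (simp add: presented_mult presented_one)
  from A show "A \<otimes>\<^bsub>presented_monoid X R\<^esub> \<one>\<^bsub>presented_monoid X R\<^esub> = A"
    by (elim presented_cases) (simp add: presented_mult presented_one)
qed (simp add: presented_one presented_class)


subsection \<open>Identities for the extension on words\<close>

lemma rho_letter_append: "rho_letter r (u @ v) x = rho_letter r v (rho_letter r u x)"
  by (induction u arbitrary: x) auto

lemma lam_letter_append:
  "lam_letter r x (u @ v) = lam_letter r x u @ lam_letter r (rho_letter r u x) v"
  by (induction u arbitrary: x) auto

lemma lam_word_append: "lam_word r (u @ v) w = lam_word r u (lam_word r v w)"
  by (induction u) auto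

lemma rho_word_append:
  "rho_word r w (u @ v) = rho_word r (lam_word r v w) u @ rho_word r w v"
  by (induction u) (auto simp: lam_word_append)

lemma lam_word_append_right:
  "lam_word r u (v @ w) = lam_word r u v @ lam_word r (rho_word r v u) w"
  by (induction u) (auto simp: lam_letter_append)

lemma rho_word_append_right: "rho_word r (v @ w) u = rho_word r w (rho_word r v u)"
  by (induction u) (auto simp: lam_word_append_right rho_letter_append)

lemma act_word_append: "act_word r (u @ v) w = act_word r u (act_word r v w)"
  by (simp add: act_word_def)

lemma act_word_Nil [simp]: "act_word r [] w = w"
  by (simp add: act_word_def)

lemma act_word_Cons: "act_word r (x # u) w = map (lam r x) (act_word r u w)"
  by (simp add: act_word_def)

lemma act_word_append_right: "act_word r u (v @ w) = act_word r u v @ act_word r u w"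
  by (induction u) (auto simp: act_word_Cons)

lemma act_word_Nil_right [simp]: "act_word r u [] = []"
  by (induction u) (auto simp: act_word_Cons)

lemma cocycle_word_append:
  "cocycle_word r (u @ v) = cocycle_word r u @ act_word r u (cocycle_word r v)"
  by (induction u) (auto simp: act_word_Cons)


subsection \<open>Compatibility with the relations\<close>

context
  fixes X :: "'a set" and r :: "'a \<times> 'a \<Rightarrow> 'a \<times> 'a"
  assumes sol: "yb_solution X r"
begin

lemma lam_bij: "x \<in> X \<Longrightarrow> bij_betw (lam r x) X X"
  using sol by (auto simp: yb_solution_def)

lemma lam_closed: "x \<in> X \<Longrightarrow> y \<in> X \<Longrightarrow> lam r x y \<in> X"
  using lam_bij by (meson bij_betwE)

lemma rho_closed: "x \<in> X \<Longrightarrow> y \<in> X \<Longrightarrow> rho r y x \<in> X"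
  using sol unfolding yb_solution_def by (meson bij_betwE)

lemma yb_components:
  assumes "x \<in> X" "y \<in> X" "z \<in> X"
  shows "lam r (lam r x y) (lam r (rho r y x) z) = lam r x (lam r y z)"
    and "rho r (lam r (rho r y x) z) (lam r x y) = lam r (rho r (lam r y z) x) (rho r z y)"
    and "rho r z (rho r y x) = rho r (rho r z y) (rho r (lam r y z) x)"
proof -
  have "(yb12 r \<circ> yb23 r \<circ> yb12 r) (x, y, z) = (yb23 r \<circ> yb12 r \<circ> yb23 r) (x, y, z)"
    using sol assms unfolding yb_solution_def yang_baxter_def by blast
  then show "lam r (lam r x y) (lam r (rho r y x) z) = lam r x (lam r y z)"
    and "rho r (lam r (rho r y x) z) (lam r x y) = lam r (rho r (lam r y z) x) (rho r z y)"
    and "rho r z (rho r y x) = rho r (rho r z y) (rho r (lam r y z) x)"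
    by (simp_all add: yb12_def yb23_def lam_def rho_def split_beta prod_eq_iff)
qed

lemma sigma_lam: "x \<in> X \<Longrightarrow> y \<in> X \<Longrightarrow>
    sigma X r (lam r x y) x = lam r (lam r x y) (rho r y x)"
  unfolding sigma_def by (simp add: bij_betw_inv_into_left[OF lam_bij])

lemma sigma_closed: "x \<in> X \<Longrightarrow> y \<in> X \<Longrightarrow> sigma X r y x \<in> X"
  unfolding sigma_def
  by (intro lam_closed rho_closed bij_betw_apply[OF bij_betw_inv_into[OF lam_bij]])

lemma lam_surj_obtain:
  assumes "x \<in> X" "z \<in> X"
  obtains y where "y \<in> X" "z = lam r x y"
  using lam_bij[OF assms(1)] assms(2) by (auto simp: bij_betw_def)

lemma lam_sigma:
  assumes "a \<in> X" "x \<in> X" "z \<in> X"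
  shows "lam r a (sigma X r z x) = sigma X r (lam r a z) (lam r a x)"
proof -
  obtain y where y: "y \<in> X" "z = lam r x y"
    using lam_surj_obtain assms by metis
  let ?x = "lam r a x" and ?a = "rho r x a"
  have cl: "?x \<in> X" "?a \<in> X" "lam r ?a y \<in> X" "rho r y x \<in> X" "lam r x y \<in> X"
    "rho r (lam r x y) a \<in> X"
    using assms y by (auto intro!: lam_closed rho_closed)
  have az: "lam r a z = lam r ?x (lam r ?a y)"
    using yb_components(1)[OF assms(1,2) y(1)] y by simp
  have "sigma X r (lam r a z) ?x = lam r (lam r a z) (rho r (lam r ?a y) ?x)"
    unfolding az using sigma_lam cl by simp
  also have "\<dots> = lam r (lam r a z) (lam r (rho r z a) (rho r y x))"
    using yb_components(2)[OF assms(1,2) y(1)] y by simp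
  also have "\<dots> = lam r a (lam r z (rho r y x))"
    using yb_components(1)[OF assms(1,3) cl(4)] by simp
  also have "\<dots> = lam r a (sigma X r z x)"
    using sigma_lam[OF assms(2) y(1)] y by simp
  finally show ?thesis by simp
qed

lemma lam_letter_closed: "x \<in> X \<Longrightarrow> w \<in> lists X \<Longrightarrow> lam_letter r x w \<in> lists X"
  by (induction w arbitrary: x) (auto intro!: lam_closed rho_closed)

lemma rho_letter_closed: "x \<in> X \<Longrightarrow> w \<in> lists X \<Longrightarrow> rho_letter r w x \<in> X"
  by (induction w arbitrary: x) (auto intro!: rho_closed)

lemma lam_word_closed: "u \<in> lists X \<Longrightarrow> w \<in> lists X \<Longrightarrow> lam_word r u w \<in> lists X"
  by (induction u) (simp_all add: lam_letter_closed)

lemma rho_word_closed: "u \<in> lists X \<Longrightarrow> w \<in> lists X \<Longrightarrow> rho_word r w u \<in> lists X"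
  by (induction u) (simp_all add: rho_letter_closed lam_word_closed)

lemma map_lam_closed: "x \<in> X \<Longrightarrow> w \<in> lists X \<Longrightarrow> map (lam r x) w \<in> lists X"
  by (induction w) (simp_all add: lam_closed)

lemma act_word_closed: "u \<in> lists X \<Longrightarrow> w \<in> lists X \<Longrightarrow> act_word r u w \<in> lists X"
  by (induction u) (simp_all add: act_word_Cons map_lam_closed)

lemma cocycle_word_closed: "u \<in> lists X \<Longrightarrow> cocycle_word r u \<in> lists X"
  by (induction u) (simp_all add: act_word_closed)

lemma rho_letter_cong:
  "(u, v) \<in> yb_cong X r \<Longrightarrow> x \<in> X \<Longrightarrow> rho_letter r u x = rho_letter r v x"
proof (induction arbitrary: x rule: word_cong.induct)
  case (rel u v)
  then obtain y z where "y \<in> X" "z \<in> X" "u = [y, z]" "v = [lam r y z, rho r z y]"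
    by (auto simp: yb_rel_def)
  with yb_components(3)[of x y z] rel.prems show ?case by simp
next
  case (append u v u' v')
  then show ?case
    by (simp add: rho_letter_append rho_letter_closed append.hyps[THEN word_cong_lists])
qed auto

lemma yb_rel_cong: "x \<in> X \<Longrightarrow> y \<in> X \<Longrightarrow> ([x, y], [lam r x y, rho r y x]) \<in> yb_cong X r"
  by (rule word_cong.rel) (auto simp: yb_rel_def lam_closed rho_closed)

lemma lam_letter_cong:
  "(u, v) \<in> yb_cong X r \<Longrightarrow> x \<in> X \<Longrightarrow> (lam_letter r x u, lam_letter r x v) \<in> yb_cong X r"
proof (induction arbitrary: x rule: word_cong.induct)
  case (rel u v)
  then obtain y z where yz: "y \<in> X" "z \<in> X" "u = [y, z]" "v = [lam r y z, rho r z y]"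
    by (auto simp: yb_rel_def)
  have "([lam r x y, lam r (rho r y x) z],
      [lam r (lam r x y) (lam r (rho r y x) z), rho r (lam r (rho r y x) z) (lam r x y)])
      \<in> yb_cong X r"
    using yz rel by (intro yb_rel_cong) (auto intro!: lam_closed rho_closed)
  then show ?case using yz yb_components(1,2)[OF rel.prems yz(1,2)] by simp
next
  case (append u v u' v')
  have "u \<in> lists X" using append.hyps(1) word_cong_lists by blast
  then have "rho_letter r u x \<in> X" using append.prems rho_letter_closed by blast
  moreover have "rho_letter r u x = rho_letter r v x"
    using append.hyps(1) append.prems by (rule rho_letter_cong)
  ultimately show ?case
    using append.IH append.prems by (simp add: lam_letter_append word_cong.append)
next
  case (refl u)
  then show ?case by (intro word_cong.refl lam_letter_closed)
next
  case (sym u v)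
  show ?case by (rule word_cong.sym) (rule sym.IH[OF sym.prems])
next
  case (trans u v w)
  show ?case by (rule word_cong.trans) (rule trans.IH[OF trans.prems])+
qed

lemma lam_word_cong_right:
  "u \<in> lists X \<Longrightarrow> (v, w) \<in> yb_cong X r \<Longrightarrow> (lam_word r u v, lam_word r u w) \<in> yb_cong X r"
  by (induction u) (simp_all add: lam_letter_cong)

lemma lam_letter_lam_letter:
  "x \<in> X \<Longrightarrow> y \<in> X \<Longrightarrow> w \<in> lists X \<Longrightarrow>
    lam_letter r x (lam_letter r y w) = lam_letter r (lam r x y) (lam_letter r (rho r y x) w)"
proof (induction w arbitrary: x y)
  case (Cons z w)
  then have z: "z \<in> X" and w: "w \<in> lists X" by simp_all
  show ?case
    using Cons.IH[of "rho r (lam r y z) x" "rho r z y"] yb_components[OF Cons.prems(1,2) z]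
      Cons.prems(1,2) z w by (simp add: lam_closed rho_closed)
qed simp

lemma lam_word_cong_left:
  "(u, v) \<in> yb_cong X r \<Longrightarrow> w \<in> lists X \<Longrightarrow> lam_word r u w = lam_word r v w"
proof (induction arbitrary: w rule: word_cong.induct)
  case (rel u v)
  then obtain x y where "x \<in> X" "y \<in> X" "u = [x, y]" "v = [lam r x y, rho r y x]"
    by (auto simp: yb_rel_def)
  with lam_letter_lam_letter[of x y w] rel.prems show ?case by simp
next
  case (append u v u' v')
  then show ?case
    by (simp add: lam_word_append lam_word_closed append.hyps[THEN word_cong_lists])
qed auto

lemma rho_word_cong_left:
  "u \<in> lists X \<Longrightarrow> (v, w) \<in> yb_cong X r \<Longrightarrow> rho_word r v u = rho_word r w u"
proof (induction u)
  case (Cons x u)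
  then show ?case
    using rho_letter_cong[OF lam_word_cong_right[of u v w]] by simp
qed simp

lemma rho_letter_rho_letter:
  assumes "x \<in> X" "y \<in> X" "w \<in> lists X"
  shows "([rho_letter r (lam_letter r y w) x, rho_letter r w y],
    [rho_letter r (lam_letter r (rho r y x) w) (lam r x y), rho_letter r w (rho r y x)])
    \<in> yb_cong X r"
  using assms
proof (induction w arbitrary: x y)
  case Nil
  then show ?case by (simp add: yb_rel_cong)
next
  case (Cons z w)
  then have z: "z \<in> X" and w: "w \<in> lists X" by simp_all
  show ?case
    using Cons.IH[of "rho r (lam r y z) x" "rho r z y"] yb_components[OF Cons.prems(1,2) z]
      Cons.prems(1,2) z w by (simp add: lam_closed rho_closed)
qed

lemma rho_word_cong_right:
  "(u, v) \<in> yb_cong X r \<Longrightarrow> w \<in> lists X \<Longrightarrow> (rho_word r w u, rho_word r w v) \<in> yb_cong X r"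
proof (induction arbitrary: w rule: word_cong.induct)
  case (rel u v)
  then obtain x y where "x \<in> X" "y \<in> X" "u = [x, y]" "v = [lam r x y, rho r y x]"
    by (auto simp: yb_rel_def)
  with rho_letter_rho_letter[of x y w] rel.prems show ?case by simp
next
  case (append u v u' v')
  have u': "u' \<in> lists X" using append.hyps(2) word_cong_lists by blast
  have "lam_word r u' w = lam_word r v' w"
    using append.hyps(2) append.prems by (rule lam_word_cong_left)
  then show ?case
    using append.IH append.prems lam_word_closed[OF u' append.prems]
    by (metis rho_word_append word_cong.append)
next
  case (refl u)
  then show ?case by (intro word_cong.refl rho_word_closed)
next
  case (sym u v)
  show ?case by (rule word_cong.sym) (rule sym.IH[OF sym.prems])
next
  case (trans u v v')
  show ?case by (rule word_cong.trans) (rule trans.IH[OF trans.prems])+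
qed

text \<open>The extension is computed on representatives, and therefore has all the properties
  listed for it on words above.\<close>

theorem yb_ext_class:
  assumes "u \<in> lists X" "v \<in> lists X"
  shows "yb_ext X r (yb_cong X r `` {u}, yb_cong X r `` {v})
    = (yb_cong X r `` {lam_word r u v}, yb_cong X r `` {rho_word r v u})"
proof -
  have "(lam_word r u v, lam_word r a b) \<in> yb_cong X r"
    "(rho_word r v u, rho_word r b a) \<in> yb_cong X r"
    if "(u, a) \<in> yb_cong X r" "(v, b) \<in> yb_cong X r" for a b
  proof -
    have a: "a \<in> lists X" and b: "b \<in> lists X"
      using that[THEN word_cong_lists] by simp_all
    show "(lam_word r u v, lam_word r a b) \<in> yb_cong X r"
      using lam_word_cong_right[OF a that(2)] lam_word_cong_left[OF that(1) assms(2)] by simp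
    show "(rho_word r v u, rho_word r b a) \<in> yb_cong X r"
      using rho_word_cong_right[OF that(1) assms(2)] rho_word_cong_left[OF a that(2)] by simp
  qed
  then show ?thesis
    using word_cong_UN2[OF assms, of "yb_rel X r" "lam_word r" "yb_rel X r"]
      word_cong_UN2[OF assms, of "yb_rel X r" "\<lambda>a b. rho_word r b a" "yb_rel X r"]
    unfolding yb_ext_def by simp
qed

corollary yb_ext_gen:
  assumes "x \<in> X" "y \<in> X"
  shows "yb_ext X r (yb_gen X r x, yb_gen X r y)
    = (yb_gen X r (lam r x y), yb_gen X r (rho r y x))"
  using yb_ext_class[of "[x]" "[y]"] assms by (simp add: yb_gen_def)

theorem yb_ext_mult:
  assumes "A \<in> carrier (yb_monoid X r)" "B \<in> carrier (yb_monoid X r)"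
  shows "A \<otimes>\<^bsub>yb_monoid X r\<^esub> B
    = lam (yb_ext X r) A B \<otimes>\<^bsub>yb_monoid X r\<^esub> rho (yb_ext X r) B A"
proof -
  have one: "([x] @ w, lam_letter r x w @ [rho_letter r w x]) \<in> yb_cong X r"
    if "x \<in> X" "w \<in> lists X" for x w
    using that
  proof (induction w arbitrary: x)
    case Nil
    then show ?case by (auto intro: word_cong.refl)
  next
    case (Cons y w)
    have y: "y \<in> X" and w: "w \<in> lists X" using Cons.prems by auto
    have "([x, y] @ w, [lam r x y, rho r y x] @ w) \<in> yb_cong X r"
      using Cons.prems y w by (intro word_cong.append yb_rel_cong word_cong.refl) auto
    moreover have "([lam r x y] @ ([rho r y x] @ w),
        [lam r x y] @ (lam_letter r (rho r y x) w @ [rho_letter r w (rho r y x)])) \<in> yb_cong X r"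
      using Cons.prems y w
      by (intro word_cong.append Cons.IH word_cong.refl) (auto intro!: lam_closed rho_closed)
    ultimately show ?case using word_cong.trans by simp
  qed
  have words: "(u @ v, lam_word r u v @ rho_word r v u) \<in> yb_cong X r"
    if "u \<in> lists X" "v \<in> lists X" for u v
    using that(1)
  proof (induction rule: lists.induct)
    case Nil
    then show ?case using that(2) by (simp add: word_cong.refl)
  next
    case (Cons x u)
    note x = Cons.hyps(1) and u = Cons.hyps(2)
    have "([x] @ (u @ v), [x] @ (lam_word r u v @ rho_word r v u)) \<in> yb_cong X r"
      by (intro word_cong.append word_cong.refl Cons.IH) (simp add: x)
    moreover have "(([x] @ lam_word r u v) @ rho_word r v u,
      (lam_letter r x (lam_word r u v) @ [rho_letter r (lam_word r u v) x]) @ rho_word r v u)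
        \<in> yb_cong X r"
      using x u that(2)
      by (intro word_cong.append one word_cong.refl) (simp_all add: lam_word_closed rho_word_closed)
    ultimately show ?case using word_cong.trans by simp
  qed
  obtain u where u: "u \<in> lists X" "A = yb_cong X r `` {u}"
    using assms(1) unfolding yb_monoid_def by (rule presented_cases)
  obtain v where v: "v \<in> lists X" "B = yb_cong X r `` {v}"
    using assms(2) unfolding yb_monoid_def by (rule presented_cases)
  from u v show ?thesis
    using words[of u v]
    by (simp add: lam_def rho_def yb_ext_class yb_monoid_def presented_mult lam_word_closed
        rho_word_closed word_cong_class_eq_iff)
qed


subsection \<open>The action and the cocycle\<close>

lemma act_word_cong_right:
  assumes "u \<in> lists X" "(v, w) \<in> derived_cong X r"
  shows "(act_word r u v, act_word r u w) \<in> derived_cong X r"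
proof -
  have letter: "(map (lam r x) v, map (lam r x) w) \<in> derived_cong X r"
    if "(v, w) \<in> derived_cong X r" "x \<in> X" for x v w
    using that
  proof (induction rule: word_cong.induct)
    case (rel u v)
    then obtain y z where yz: "y \<in> X" "z \<in> X" "u = [y, z]" "v = [z, sigma X r z y]"
      by (auto simp: derived_rel_def)
    have "(map (lam r x) u, map (lam r x) v) \<in> derived_rel X r"
      using yz that(2) lam_sigma[OF that(2) yz(1,2)] by (auto simp: derived_rel_def lam_closed)
    then show ?case
      using yz that(2) by (intro word_cong.rel) (simp_all add: lam_closed sigma_closed)
  next
    case (refl u)
    then show ?case using that(2) by (intro word_cong.refl map_lam_closed)
  next
    case (sym u v)
    show ?case by (rule word_cong.sym) (rule sym.IH[OF sym.prems])
  next
    case (trans u v w)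
    show ?case by (rule word_cong.trans) (rule trans.IH[OF trans.prems])+
  next
    case (append u v u' v')
    then show ?case by (simp add: word_cong.append)
  qed
  from assms show ?thesis
    by (induction u) (simp_all add: act_word_Cons letter)
qed

lemma act_word_cong_left:
  "(u, v) \<in> yb_cong X r \<Longrightarrow> w \<in> lists X \<Longrightarrow> act_word r u w = act_word r v w"
proof (induction arbitrary: w rule: word_cong.induct)
  case (rel u v)
  then obtain x y where xy: "x \<in> X" "y \<in> X" "u = [x, y]" "v = [lam r x y, rho r y x]"
    by (auto simp: yb_rel_def)
  then show ?case
    using rel.prems yb_components(1)[OF xy(1,2)] by (auto simp: act_word_Cons)
next
  case (append u v u' v')
  then show ?case
    by (simp add: act_word_append act_word_closed append.hyps[THEN word_cong_lists])
qed auto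

lemma cocycle_word_cong:
  "(u, v) \<in> yb_cong X r \<Longrightarrow> (cocycle_word r u, cocycle_word r v) \<in> derived_cong X r"
proof (induction rule: word_cong.induct)
  case (rel u v)
  then obtain x y where xy: "x \<in> X" "y \<in> X" "u = [x, y]" "v = [lam r x y, rho r y x]"
    by (auto simp: yb_rel_def)
  have "([x, lam r x y], [lam r x y, sigma X r (lam r x y) x]) \<in> derived_cong X r"
    using xy by (intro word_cong.rel) (auto simp: derived_rel_def lam_closed sigma_closed)
  then show ?case
    using xy by (simp add: act_word_Cons sigma_lam)
next
  case (append u v u' v')
  have l: "u \<in> lists X" "v' \<in> lists X"
    using append.hyps word_cong_lists by blast+
  have "act_word r u (cocycle_word r v') = act_word r v (cocycle_word r v')"
    using append.hyps(1) cocycle_word_closed[OF l(2)] by (rule act_word_cong_left)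
  then show ?case
    using append.IH act_word_cong_right[OF l(1) append.IH(2)]
    by (simp add: cocycle_word_append word_cong.append)
next
  case (refl u)
  then show ?case by (intro word_cong.refl cocycle_word_closed)
next
  case (sym u v)
  show ?case by (rule word_cong.sym) (rule sym.IH)
next
  case (trans u v w)
  show ?case by (rule word_cong.trans) (rule trans.IH)+
qed

theorem yb_act_class:
  assumes "u \<in> lists X" "v \<in> lists X"
  shows "yb_act X r (yb_cong X r `` {u}) (derived_cong X r `` {v})
    = derived_cong X r `` {act_word r u v}"
proof -
  have eq: "derived_cong X r `` {act_word r a b} = derived_cong X r `` {act_word r u v}"
    if "(u, a) \<in> yb_cong X r" "(v, b) \<in> derived_cong X r" for a b
  proof -
    have a: "a \<in> lists X"
      using that(1)[THEN word_cong_lists] by simp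
    have "(act_word r u v, act_word r a b) \<in> derived_cong X r"
      using act_word_cong_right[OF a that(2)] act_word_cong_left[OF that(1) assms(2)] by simp
    then show ?thesis
      by (rule equiv_class_eq[OF equiv_word_cong, THEN HOL.sym])
  qed
  have "yb_act X r (yb_cong X r `` {u}) (derived_cong X r `` {v})
    = (\<Union>a \<in> yb_cong X r `` {u}. \<Union>b \<in> derived_cong X r `` {v}. derived_cong X r `` {act_word r u v})"
    unfolding yb_act_def by (intro SUP_cong HOL.refl) (simp add: eq)
  also have "\<dots> = derived_cong X r `` {act_word r u v}"
  proof -
    have "u \<in> yb_cong X r `` {u}" "v \<in> derived_cong X r `` {v}"
      using assms by (simp_all only: Image_singleton_iff word_cong.refl)
    then have "yb_cong X r `` {u} \<noteq> {}" "derived_cong X r `` {v} \<noteq> {}"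
      by (metis empty_iff)+
    then show ?thesis by (simp only: UN_constant if_False)
  qed
  finally show ?thesis .
qed

theorem yb_cocycle_class:
  assumes "u \<in> lists X"
  shows "yb_cocycle X r (yb_cong X r `` {u}) = derived_cong X r `` {cocycle_word r u}"
proof -
  have eq: "derived_cong X r `` {cocycle_word r a} = derived_cong X r `` {cocycle_word r u}"
    if "(u, a) \<in> yb_cong X r" for a
    using that by (intro equiv_class_eq[OF equiv_word_cong, THEN HOL.sym] cocycle_word_cong)
  have "yb_cocycle X r (yb_cong X r `` {u})
    = (\<Union>a \<in> yb_cong X r `` {u}. derived_cong X r `` {cocycle_word r u})"
    unfolding yb_cocycle_def by (intro SUP_cong HOL.refl) (simp add: eq)
  also have "\<dots> = derived_cong X r `` {cocycle_word r u}"
  proof -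
    have "u \<in> yb_cong X r `` {u}"
      using assms by (simp only: Image_singleton_iff word_cong.refl)
    then have "yb_cong X r `` {u} \<noteq> {}"
      by (metis empty_iff)
    then show ?thesis by (simp only: UN_constant if_False)
  qed
  finally show ?thesis .
qed

corollary yb_cocycle_gen: "x \<in> X \<Longrightarrow> yb_cocycle X r (yb_gen X r x) = derived_gen X r x"
  using yb_cocycle_class[of "[x]"] by (simp add: yb_gen_def derived_gen_def)

corollary yb_cocycle_mult:
  assumes "A \<in> carrier (yb_monoid X r)" "B \<in> carrier (yb_monoid X r)"
  shows "yb_cocycle X r (A \<otimes>\<^bsub>yb_monoid X r\<^esub> B)
    = yb_cocycle X r A \<otimes>\<^bsub>derived_monoid X r\<^esub> yb_act X r A (yb_cocycle X r B)"
proof -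
  obtain u where u: "u \<in> lists X" "A = yb_cong X r `` {u}"
    using assms(1) unfolding yb_monoid_def by (rule presented_cases)
  obtain v where v: "v \<in> lists X" "B = yb_cong X r `` {v}"
    using assms(2) unfolding yb_monoid_def by (rule presented_cases)
  from u v show ?thesis
    unfolding yb_monoid_def derived_monoid_def
    by (simp add: presented_mult yb_cocycle_class yb_act_class cocycle_word_append
        cocycle_word_closed act_word_closed)
qed

lemma cocycle_word_lam_letter:
  "x \<in> X \<Longrightarrow> w \<in> lists X \<Longrightarrow> cocycle_word r (lam_letter r x w) = act_word r [x] (cocycle_word r w)"
proof (induction w arbitrary: x)
  case (Cons y w)
  have y: "y \<in> X" and w: "w \<in> lists X" using Cons.prems by auto
  have "cocycle_word r w \<in> lists X" using w by (rule cocycle_word_closed)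
  then show ?case
    using Cons.IH[of "rho r y x"] Cons.prems y w
    by (auto simp: act_word_Cons rho_closed yb_components(1))
qed simp

theorem yb_cocycle_lam:
  assumes "A \<in> carrier (yb_monoid X r)" "B \<in> carrier (yb_monoid X r)"
  shows "yb_cocycle X r (lam (yb_ext X r) A B) = yb_act X r A (yb_cocycle X r B)"
proof -
  obtain u where u: "u \<in> lists X" "A = yb_cong X r `` {u}"
    using assms(1) unfolding yb_monoid_def by (rule presented_cases)
  obtain v where v: "v \<in> lists X" "B = yb_cong X r `` {v}"
    using assms(2) unfolding yb_monoid_def by (rule presented_cases)
  note uv = u(1) v(1) u(2) v(2)
  have "cocycle_word r (lam_word r u v) = act_word r u (cocycle_word r v)"
    using uv(1)
  proof (induction rule: lists.induct)
    case (Cons x u)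
    have "x \<in> X" "lam_word r u v \<in> lists X"
      using Cons.hyps uv(2) by (simp_all add: lam_word_closed)
    then show ?case using Cons.IH by (simp add: cocycle_word_lam_letter act_word_Cons)
  qed simp
  then show ?thesis
    using uv by (simp add: lam_def yb_ext_class yb_cocycle_class yb_act_class lam_word_closed
        cocycle_word_closed)
qed

lemma act_word_obtain:
  assumes "u \<in> lists X" "w \<in> lists X"
  obtains v where "v \<in> lists X" "act_word r u v = w"
proof -
  have letter: "\<exists>v \<in> lists X. map (lam r x) v = w" if x: "x \<in> X" and "w \<in> lists X" for x w
    using that(2)
  proof (induction rule: lists.induct)
    case Nil
    then show ?case by (intro bexI[of _ "[]"]) simp_all
  next
    case (Cons z w)
    obtain y where y: "y \<in> X" "z = lam r x y"
      using Cons.hyps(1) by (rule lam_surj_obtain[OF x])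
    obtain v where v: "v \<in> lists X" "map (lam r x) v = w"
      using Cons.IH by (rule bexE)
    show ?case
      using y v by (intro bexI[of _ "y # v"]) simp_all
  qed
  have "\<exists>v \<in> lists X. act_word r u v = w"
    using assms
  proof (induction arbitrary: w rule: lists.induct)
    case Nil
    then show ?case by (intro bexI[of _ w]) simp_all
  next
    case (Cons x u)
    obtain w' where w': "w' \<in> lists X" "map (lam r x) w' = w"
      using letter[OF Cons.hyps(1) Cons.prems(1)] by (rule bexE)
    obtain v where "v \<in> lists X" "act_word r u v = w'"
      using Cons.IH[OF w'(1)] by (rule bexE)
    with w'(2) show ?case by (intro bexI[of _ v]) (simp_all add: act_word_Cons)
  qed
  then show ?thesis by (rule bexE) (rule that)
qed

lemma act_word_inj:
  "u \<in> lists X \<Longrightarrow> v \<in> lists X \<Longrightarrow> w \<in> lists X \<Longrightarrow> act_word r u v = act_word r u w \<Longrightarrow> v = w"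
proof (induction u)
  case (Cons x u)
  have x: "x \<in> X" and u: "u \<in> lists X" using Cons.prems(1) by simp_all
  have "inj_on (lam r x) X"
    using lam_bij[OF x] by (rule bij_betw_imp_inj_on)
  moreover have "set (act_word r u v) \<subseteq> X" "set (act_word r u w) \<subseteq> X"
    using act_word_closed[OF u Cons.prems(2)] act_word_closed[OF u Cons.prems(3)]
    by (simp_all only: lists_eq_set mem_Collect_eq)
  ultimately have inj: "inj_on (lam r x) (set (act_word r u v) \<union> set (act_word r u w))"
    by (meson Un_least inj_on_subset)
  have "act_word r u v = act_word r u w"
    using Cons.prems(4) inj by (simp only: act_word_Cons map_inj_on)
  then show ?case by (rule Cons.IH[OF u Cons.prems(2,3)])
qed simp

lemma cocycle_word_obtain:
  assumes "w \<in> lists X"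
  obtains u where "u \<in> lists X" "cocycle_word r u = w"
proof -
  have "\<exists>u \<in> lists X. cocycle_word r u = w"
    using assms
  proof (induction "length w" arbitrary: w)
    case 0
    then show ?case by (intro bexI[of _ "[]"]) simp_all
  next
    case (Suc n)
    obtain x w' where w: "w = x # w'" using Suc.hyps(2) by (cases w) simp_all
    have x: "[x] \<in> lists X" and w': "w' \<in> lists X" using Suc.prems w by simp_all
    obtain w'' where w'': "w'' \<in> lists X" "act_word r [x] w'' = w'"
      using x w' by (rule act_word_obtain)
    have "n = length w''"
      using Suc.hyps(2) w arg_cong[OF w''(2), of length] by (simp add: act_word_Cons)
    from Suc.hyps(1)[OF this w''(1)] obtain u where "u \<in> lists X" "cocycle_word r u = w''"
      by (rule bexE)
    with x w w''(2) show ?case by (intro bexI[of _ "x # u"]) simp_all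
  qed
  then show ?thesis by (rule bexE) (rule that)
qed

lemma cocycle_word_inj:
  "u \<in> lists X \<Longrightarrow> v \<in> lists X \<Longrightarrow> cocycle_word r u = cocycle_word r v \<Longrightarrow> u = v"
proof (induction u arbitrary: v)
  case Nil
  from Nil.prems(3) show ?case by (cases v) auto
next
  case (Cons x u)
  obtain v' where v: "v = x # v'" using Cons.prems(3) by (cases v) simp_all
  have "cocycle_word r u = cocycle_word r v'"
    by (rule act_word_inj[of "[x]"]) (use Cons.prems v in \<open>simp_all add: cocycle_word_closed\<close>)
  moreover have "u \<in> lists X" "v' \<in> lists X"
    using Cons.prems(1,2) v by simp_all
  ultimately have "u = v'" by (rule Cons.IH[rotated 2])
  then show ?case using v by simp
qed

lemma length_act_word [simp]: "length (act_word r u w) = length w"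
  by (induction u) (simp_all add: act_word_Cons)

lemma length_cocycle_word [simp]: "length (cocycle_word r u) = length u"
  by (induction u) simp_all

lemma cocycle_word_append_split:
  assumes "act_word r a (cocycle_word r u) = p @ q"
  obtains u1 u2 where "u = u1 @ u2" "act_word r a (cocycle_word r u1) = p"
    "act_word r (a @ u1) (cocycle_word r u2) = q"
proof -
  define u1 u2 where "u1 = take (length p) u" and "u2 = drop (length p) u"
  have u: "u = u1 @ u2" by (simp add: u1_def u2_def)
  have "length u = length p + length q"
    using arg_cong[OF assms, of length] by simp
  then have len: "length (act_word r a (cocycle_word r u1)) = length p"
    by (simp add: u1_def)
  have "act_word r a (cocycle_word r u1) @ act_word r (a @ u1) (cocycle_word r u2) = p @ q"
    using assms by (simp add: u cocycle_word_append act_word_append act_word_append_right)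
  with len have "act_word r a (cocycle_word r u1) = p \<and> act_word r (a @ u1) (cocycle_word r u2) = q"
    by (metis append_eq_append_conv)
  then show ?thesis using that[OF u] by blast
qed

text \<open>Splitting a word lets its left part act on the cocycle of its right part, hence the
  generalisation over \<open>a\<close>.\<close>

lemma cocycle_word_reflect:
  "(p, q) \<in> derived_cong X r \<Longrightarrow> a \<in> lists X \<Longrightarrow> u \<in> lists X \<Longrightarrow> v \<in> lists X \<Longrightarrow>
    act_word r a (cocycle_word r u) = p \<Longrightarrow> act_word r a (cocycle_word r v) = q \<Longrightarrow>
    (u, v) \<in> yb_cong X r"
proof (induction arbitrary: a u v rule: word_cong.induct)
  case (rel p q)
  then obtain x z where xz: "x \<in> X" "z \<in> X" "p = [x, z]" "q = [z, sigma X r z x]"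
    by (auto simp: derived_rel_def)
  have "length u = 2"
    using arg_cong[OF rel.prems(4), of length] xz by simp
  then obtain x' y where u: "u = [x', y]"
    by (auto simp: length_Suc_conv numeral_2_eq_2)
  have xy: "x' \<in> X" "y \<in> X" using rel.prems(2) u by simp_all
  define z' where "z' = lam r x' y"
  have z': "z' \<in> X" using xy by (simp add: z'_def lam_closed)
  have act: "act_word r b [s] = [t] \<Longrightarrow> act_word r b [s'] = [t'] \<Longrightarrow> b \<in> lists X \<Longrightarrow> s \<in> X \<Longrightarrow> s' \<in> X \<Longrightarrow>
      act_word r b [sigma X r s s'] = [sigma X r t t'] \<and> t \<in> X \<and> t' \<in> X" for b s s' t t'
  proof (induction b arbitrary: t t')
    case (Cons c b)
    obtain t0 t0' where t0: "act_word r b [s] = [t0]" "act_word r b [s'] = [t0']"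
    proof -
      have "\<exists>t0. act_word r b [z] = [t0]" for z
        using length_act_word[of b "[z]"] by (cases "act_word r b [z]") simp_all
      then show ?thesis using that by metis
    qed
    then have IH: "act_word r b [sigma X r s s'] = [sigma X r t0 t0'] \<and> t0 \<in> X \<and> t0' \<in> X"
      using Cons.IH Cons.prems by simp
    then show ?case
      using Cons.prems t0 lam_sigma[of c t0' t0] by (auto simp: act_word_Cons lam_closed)
  qed simp
  have p: "act_word r a ([x'] @ [z']) = [x] @ [z]"
    using rel.prems(4) u xz(3) by (simp add: act_word_Cons z'_def)
  then have p2: "act_word r a [x'] = [x]" "act_word r a [z'] = [z]"
    using append_eq_append_conv[of "act_word r a [x']" "[x]"]
    unfolding act_word_append_right by simp_all
  have "act_word r a ([z'] @ [sigma X r z' x']) = [z] @ [sigma X r z x]"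
    using p2 act[OF p2(2,1) rel.prems(1) z' xy(1)] unfolding act_word_append_right by simp
  then have "act_word r a (cocycle_word r v) = act_word r a (cocycle_word r [z', rho r y x'])"
    using rel.prems(5) xz(4) xy by (simp add: act_word_Cons z'_def sigma_lam)
  then have "cocycle_word r v = cocycle_word r [z', rho r y x']"
    by (rule act_word_inj[of a, rotated 3])
      (use rel.prems xy z' in \<open>simp_all add: cocycle_word_closed act_word_closed rho_closed del: cocycle_word.simps\<close>)
  then have "v = [z', rho r y x']"
    by (rule cocycle_word_inj[rotated 2]) (use rel.prems xy z' in \<open>simp_all add: rho_closed\<close>)
  then show ?case using yb_rel_cong[OF xy] u z'_def by simp
next
  case (refl p)
  have "cocycle_word r u = cocycle_word r v"
    by (rule act_word_inj[of a]) (use refl.prems in \<open>simp_all add: cocycle_word_closed\<close>)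
  then have "u = v"
    by (rule cocycle_word_inj[OF refl.prems(2,3)])
  then show ?case using refl.prems by (simp add: word_cong.refl)
next
  case (sym p q)
  show ?case
    by (rule word_cong.sym)
      (rule sym.IH[OF sym.prems(1) sym.prems(3) sym.prems(2) sym.prems(5) sym.prems(4)])
next
  case (trans p q s)
  have "q \<in> lists X" using word_cong_lists[OF trans.hyps(1)] by simp
  then obtain w' where w': "w' \<in> lists X" "act_word r a w' = q"
    by (rule act_word_obtain[OF trans.prems(1)])
  obtain w where w: "w \<in> lists X" "cocycle_word r w = w'"
    using w'(1) by (rule cocycle_word_obtain)
  then have q: "act_word r a (cocycle_word r w) = q" using w'(2) by simp
  show ?case
    using trans.IH(1)[OF trans.prems(1,2) w(1) trans.prems(4) q]
      trans.IH(2)[OF trans.prems(1) w(1) trans.prems(3) q trans.prems(5)]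
    by (rule word_cong.trans)
next
  case (append p q p' q')
  obtain u1 u2 where u: "u = u1 @ u2" "act_word r a (cocycle_word r u1) = p"
    "act_word r (a @ u1) (cocycle_word r u2) = p'"
    using append.prems(4) by (rule cocycle_word_append_split)
  obtain v1 v2 where v: "v = v1 @ v2" "act_word r a (cocycle_word r v1) = q"
    "act_word r (a @ v1) (cocycle_word r v2) = q'"
    using append.prems(5) by (rule cocycle_word_append_split)
  have l: "u1 \<in> lists X" "u2 \<in> lists X" "v1 \<in> lists X" "v2 \<in> lists X" "a @ u1 \<in> lists X"
    using append.prems u(1) v(1) by simp_all
  have 1: "(u1, v1) \<in> yb_cong X r"
    using append.IH(1)[OF append.prems(1) l(1,3) u(2) v(2)] .
  have "act_word r (a @ u1) (cocycle_word r v2) = q'"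
    using v(3) act_word_cong_left[OF 1 cocycle_word_closed[OF l(4)]] by (simp add: act_word_append)
  then have "(u2, v2) \<in> yb_cong X r"
    using append.IH(2)[OF l(5,2,4) u(3)] by simp
  with 1 show ?case unfolding u(1) v(1) by (rule word_cong.append)
qed

theorem yb_cocycle_bij:
  "bij_betw (yb_cocycle X r) (carrier (yb_monoid X r)) (carrier (derived_monoid X r))"
proof (rule bij_betw_imageI)
  show "inj_on (yb_cocycle X r) (carrier (yb_monoid X r))"
  proof (rule inj_onI)
    fix A B
    assume AB: "A \<in> carrier (yb_monoid X r)" "B \<in> carrier (yb_monoid X r)"
      "yb_cocycle X r A = yb_cocycle X r B"
    obtain u where u: "u \<in> lists X" "A = yb_cong X r `` {u}"
      using AB(1) unfolding yb_monoid_def by (rule presented_cases)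
    obtain v where v: "v \<in> lists X" "B = yb_cong X r `` {v}"
      using AB(2) unfolding yb_monoid_def by (rule presented_cases)
    have "(cocycle_word r u, cocycle_word r v) \<in> derived_cong X r"
      using AB(3) u v by (simp add: yb_cocycle_class word_cong_class_eq_iff cocycle_word_closed)
    then have "(u, v) \<in> yb_cong X r"
      by (rule cocycle_word_reflect[of _ _ "[]"]) (simp_all add: u v)
    then show "A = B"
      using u v by (simp add: word_cong_class_eq_iff)
  qed
  show "yb_cocycle X r ` carrier (yb_monoid X r) = carrier (derived_monoid X r)"
  proof (rule subset_antisym; rule subsetI)
    fix B assume "B \<in> yb_cocycle X r ` carrier (yb_monoid X r)"
    then obtain A where A: "A \<in> carrier (yb_monoid X r)" "B = yb_cocycle X r A" by (rule imageE)
    obtain u where u: "u \<in> lists X" "A = yb_cong X r `` {u}"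
      using A(1) unfolding yb_monoid_def by (rule presented_cases)
    then show "B \<in> carrier (derived_monoid X r)"
      by (simp add: A yb_cocycle_class derived_monoid_def presented_class cocycle_word_closed)
  next
    fix B assume "B \<in> carrier (derived_monoid X r)"
    then obtain w where w: "w \<in> lists X" "B = derived_cong X r `` {w}"
      unfolding derived_monoid_def by (rule presented_cases)
    obtain u where u: "u \<in> lists X" "cocycle_word r u = w"
      using w(1) by (rule cocycle_word_obtain)
    then have "B = yb_cocycle X r (yb_cong X r `` {u})"
      using w by (simp add: yb_cocycle_class)
    then show "B \<in> yb_cocycle X r ` carrier (yb_monoid X r)"
      using u by (simp add: yb_monoid_def presented_class)
  qed
qed

corollary yb_add_iso: "yb_cocycle X r \<in> iso (yb_add_monoid X r) (derived_monoid X r)"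
proof (rule isoI)
  interpret D: monoid "derived_monoid X r"
    unfolding derived_monoid_def by (rule presented_monoid)
  show "yb_cocycle X r \<in> hom (yb_add_monoid X r) (derived_monoid X r)"
    using bij_betwE[OF yb_cocycle_bij] bij_betw_imp_surj_on[OF yb_cocycle_bij]
    by (auto simp: hom_def yb_add_monoid_def intro!: f_inv_into_f)
  show "bij_betw (yb_cocycle X r) (carrier (yb_add_monoid X r)) (carrier (derived_monoid X r))"
    using yb_cocycle_bij by (simp add: yb_add_monoid_def)
qed

corollary yb_cocycle_one: "yb_cocycle X r \<one>\<^bsub>yb_add_monoid X r\<^esub> = \<one>\<^bsub>derived_monoid X r\<^esub>"
  using yb_cocycle_class[of "[]"]
  by (simp add: yb_add_monoid_def yb_monoid_def derived_monoid_def presented_one)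

corollary yb_mult_add:
  assumes "A \<in> carrier (yb_monoid X r)" "B \<in> carrier (yb_monoid X r)"
  shows "A \<otimes>\<^bsub>yb_monoid X r\<^esub> B = A \<otimes>\<^bsub>yb_add_monoid X r\<^esub> lam (yb_ext X r) A B"
proof -
  have "A \<otimes>\<^bsub>yb_monoid X r\<^esub> B \<in> carrier (yb_monoid X r)"
    using assms unfolding yb_monoid_def by (rule monoid.m_closed[OF presented_monoid])
  then show ?thesis
    using bij_betw_inv_into_left[OF yb_cocycle_bij]
    by (simp add: yb_add_monoid_def yb_cocycle_lam[OF assms] yb_cocycle_mult[OF assms, symmetric])
qed

end

end

theory Submission
  imports Defs
begin

text \<open>
  The multiple \<open>k x\<close> is the class of a word \<open>x\<^sub>1 \<dots> x\<^sub>k\<close> with \<open>x\<^sub>1 = x\<close> and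
  \<open>\<lambda>\<^bsub>x\<^sub>i\<^esub>(x\<^bsub>i+1\<^esub>) = x\<^sub>i\<close>: the cocycle of such a word is \<open>x \<dots> x\<close>, because each factor \<open>\<lambda>\<^bsub>x\<^sub>i\<^esub>\<close>
  turns a constant word in \<open>x\<^bsub>i+1\<^esub>\<close> into a constant word in \<open>x\<^sub>i\<close>
  (\<open>constant_cocycle_iff_multiple_word\<close>). So \<open>kX\<close> is the image in \<open>M\<close> of a finite set of words,
  \<open>multiple_words\<close>, and the whole argument can be carried out with words, where equalities can
  be checked letter by letter, instead of in \<open>M\<close>, which need not be cancellative.

  The extension of \<open>r\<close> preserves the condition \<open>\<lambda>\<^sub>x(y) = x\<close> on neighbouring letters, by the
  first two component identities of the Yang--Baxter equation: the first one gives
  \<open>\<lambda>\<^bsub>\<lambda>\<^sub>a(x)\<^esub>(\<lambda>\<^bsub>\<rho>\<^sub>x(a)\<^esub>(y)) = \<lambda>\<^sub>a(\<lambda>\<^sub>x(y)) = \<lambda>\<^sub>a(x)\<close>, and it also gives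
  \<open>\<lambda>\<^bsub>\<rho>\<^sub>y(x)\<^esub> = \<lambda>\<^sub>y\<close> as soon as \<open>\<lambda>\<^sub>x(y) = x\<close>, after which the second one yields the invariance
  under \<open>\<rho>\<close>.

  The word version of \<open>r\<close> satisfies the Yang--Baxter equation on the nose and is injective, as are its
  components \<open>\<lambda>\<^sub>u\<close> and \<open>\<rho>\<^sub>v\<close>. On the finite set of words above the maps are therefore bijective,
  so the maps that they induce on the finite set \<open>kX\<close> of classes are surjective, hence bijective
  (\<open>bij_betw_induced\<close>). Injectivity itself does not pass to classes directly, since different
  words may have the same class: for instance \<open>2 x = 2 \<sigma>\<^sub>x(x)\<close> in \<open>(M, +)\<close>.
\<close>

section \<open>Finite quotients and restrictions\<close>

text \<open>An injective self-map of a finite set is surjective, surjectivity passes to any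
  quotient, and on a finite quotient it gives back injectivity.\<close>

lemma bij_betw_induced:
  assumes "finite K" and inj: "inj_on f K" and "f ` K \<subseteq> K"
    and F: "\<And>x. x \<in> K \<Longrightarrow> F (c x) = c (f x)"
  shows "bij_betw F (c ` K) (c ` K)"
proof -
  have "f ` K = K"
    using assms(1,3) inj by (intro endo_inj_surj)
  moreover have "F ` c ` K = c ` f ` K"
    using F by (auto simp: image_iff)
  ultimately have "F ` c ` K = c ` K" by simp
  moreover from this have "inj_on F (c ` K)"
    using assms(1) by (intro finite_surj_inj) auto
  ultimately show ?thesis by (simp add: bij_betw_def)
qed

lemma yang_baxter_restrict:
  assumes "r \<in> Y \<times> Y \<rightarrow> Y \<times> Y" "yang_baxter Y r"
  shows "yang_baxter Y (restrict r (Y \<times> Y))"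
  unfolding yang_baxter_def
proof
  fix t assume t: "t \<in> Y \<times> Y \<times> Y"
  have cl: "yb12 r s \<in> Y \<times> Y \<times> Y" "yb23 r s \<in> Y \<times> Y \<times> Y" if "s \<in> Y \<times> Y \<times> Y" for s
    using that funcset_mem[OF assms(1), of "(fst s, fst (snd s))"] funcset_mem[OF assms(1), of "snd s"]
    by (auto simp: yb12_def yb23_def split_beta mem_Times_iff)
  have eq: "yb12 (restrict r (Y \<times> Y)) s = yb12 r s" "yb23 (restrict r (Y \<times> Y)) s = yb23 r s"
    if "s \<in> Y \<times> Y \<times> Y" for s
    using that by (auto simp: yb12_def yb23_def)
  show "(yb12 (restrict r (Y \<times> Y)) \<circ> yb23 (restrict r (Y \<times> Y)) \<circ> yb12 (restrict r (Y \<times> Y))) t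
    = (yb23 (restrict r (Y \<times> Y)) \<circ> yb12 (restrict r (Y \<times> Y)) \<circ> yb23 (restrict r (Y \<times> Y))) t"
    using bspec[OF assms(2)[unfolded yang_baxter_def] t] t by (simp add: cl eq)
qed

section \<open>The extension of a solution to words\<close>

lemma length_lam_word: "length (lam_word r u w) = length w"
proof -
  have "length (lam_letter r x w) = length w" for x w
    by (induction w arbitrary: x) auto
  then show ?thesis by (induction u) auto
qed

lemma length_rho_word: "length (rho_word r w u) = length u"
  by (induction u) auto

context
  fixes X :: "'a set" and r :: "'a \<times> 'a \<Rightarrow> 'a \<times> 'a"
  assumes sol: "yb_solution X r"
begin

lemmas letter_closed = lam_closed[OF sol] rho_closed[OF sol]

lemmas word_closed = lam_letter_closed[OF sol] rho_letter_closed[OF sol]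
  lam_word_closed[OF sol] rho_word_closed[OF sol]

subsection \<open>The Yang--Baxter equation\<close>

lemma letter_word_cong:
  "x \<in> X \<Longrightarrow> w \<in> lists X \<Longrightarrow> (x # w, lam_letter r x w @ [rho_letter r w x]) \<in> yb_cong X r"
  using yb_ext_mult[OF sol, of "yb_cong X r `` {[x]}" "yb_cong X r `` {w}"]
  by (simp add: yb_ext_class[OF sol] lam_def rho_def yb_monoid_def presented_class presented_mult
      word_closed word_cong_class_eq_iff)

lemma word_word_cong:
  "u \<in> lists X \<Longrightarrow> v \<in> lists X \<Longrightarrow> (u @ v, lam_word r u v @ rho_word r v u) \<in> yb_cong X r"
  using yb_ext_mult[OF sol, of "yb_cong X r `` {u}" "yb_cong X r `` {v}"]
  by (simp add: yb_ext_class[OF sol] lam_def rho_def yb_monoid_def presented_class presented_mult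
      word_closed word_cong_class_eq_iff)

lemma lam_word_lam_word:
  "u \<in> lists X \<Longrightarrow> v \<in> lists X \<Longrightarrow> w \<in> lists X \<Longrightarrow>
    lam_word r (lam_word r u v) (lam_word r (rho_word r v u) w) = lam_word r u (lam_word r v w)"
  using lam_word_cong_left[OF sol word_word_cong] by (simp add: lam_word_append)

lemma rho_word_rho_word:
  "u \<in> lists X \<Longrightarrow> v \<in> lists X \<Longrightarrow> w \<in> lists X \<Longrightarrow>
    rho_word r w (rho_word r v u) = rho_word r (rho_word r w v) (rho_word r (lam_word r v w) u)"
  using rho_word_cong_left[OF sol _ word_word_cong] by (simp add: rho_word_append_right)

text \<open>The middle component does not follow from the relations of the monoid: comparing the two
  factorisations of \<open>\<lambda>\<^sub>u(v \<circ> w)\<close> would need cancellation. It is built up from letters, one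
  argument at a time.\<close>

lemma rho_lam_letters:
  "x \<in> X \<Longrightarrow> y \<in> X \<Longrightarrow> w \<in> lists X \<Longrightarrow>
    rho_letter r (lam_letter r (rho r y x) w) (lam r x y)
    = lam r (rho_letter r (lam_letter r y w) x) (rho_letter r w y)"
proof (induction w arbitrary: x y)
  case (Cons z w)
  then have z: "z \<in> X" and w: "w \<in> lists X" by simp_all
  show ?case
    using Cons.IH[of "rho r (lam r y z) x" "rho r z y"] yb_components[OF sol Cons.prems(1,2) z]
      Cons.prems(1,2) z w by (simp add: letter_closed)
qed simp

lemma rho_lam_letter:
  "x \<in> X \<Longrightarrow> v \<in> lists X \<Longrightarrow> w \<in> lists X \<Longrightarrow>
    rho_word r (lam_letter r (rho_letter r v x) w) (lam_letter r x v)
    = lam_letter r (rho_letter r (lam_word r v w) x) (rho_word r w v)"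
proof (induction v arbitrary: x)
  case (Cons y v)
  then have y: "y \<in> X" and v: "v \<in> lists X" by simp_all
  note x = Cons.prems(1) and w = Cons.prems(3)
  let ?x = "rho r y x" and ?W = "lam_word r v w"
  have W: "?W \<in> lists X" using v w by (rule word_closed)
  have x': "?x \<in> X" using x y by (simp add: letter_closed)
  have "lam_word r (lam_letter r ?x v) (lam_letter r (rho_letter r v ?x) w) = lam_letter r ?x ?W"
    using lam_word_lam_word[of "[?x]" v w] x' v w by simp
  moreover have "rho r (rho_letter r ?W y) (rho_letter r (lam_letter r y ?W) x) = rho_letter r ?W ?x"
    using rho_letter_cong[OF sol letter_word_cong[OF y W] x] by (simp add: rho_letter_append)
  ultimately show ?case
    using Cons.IH[OF x' v w] rho_lam_letters[OF x y W] by simp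
qed simp

lemma rho_lam_word:
  "u \<in> lists X \<Longrightarrow> v \<in> lists X \<Longrightarrow> w \<in> lists X \<Longrightarrow>
    rho_word r (lam_word r (rho_word r v u) w) (lam_word r u v)
    = lam_word r (rho_word r (lam_word r v w) u) (rho_word r w v)"
proof (induction u)
  case (Cons x u)
  then have x: "x \<in> X" and u: "u \<in> lists X" by simp_all
  show ?case
    using Cons.IH[OF u Cons.prems(2,3)] lam_word_lam_word[OF u Cons.prems(2,3)]
      rho_lam_letter[OF x, of "lam_word r u v" "lam_word r (rho_word r v u) w"] u Cons.prems(2,3)
    by (simp add: word_closed)
qed simp

subsection \<open>Injectivity\<close>

lemma inj_on_lam_letter: "x \<in> X \<Longrightarrow> inj_on (lam_letter r x) (lists X)"
proof (rule inj_onI)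
  fix u v
  show "x \<in> X \<Longrightarrow> u \<in> lists X \<Longrightarrow> v \<in> lists X \<Longrightarrow> lam_letter r x u = lam_letter r x v \<Longrightarrow> u = v"
  proof (induction u arbitrary: x v)
    case Nil
    then show ?case by (cases v) auto
  next
    case (Cons y u)
    obtain z v' where v: "v = z # v'" using Cons.prems(4) by (cases v) auto
    have yz: "y \<in> X" "z \<in> X" "lam r x y = lam r x z" using Cons.prems v by auto
    then have "y = z"
      using lam_bij[OF sol Cons.prems(1)] by (auto simp: bij_betw_def dest: inj_onD)
    then show ?case
      using Cons.IH[of "rho r y x" v'] Cons.prems v by (auto simp: letter_closed)
  qed
qed

lemma inj_on_lam_word: "u \<in> lists X \<Longrightarrow> inj_on (lam_word r u) (lists X)"
proof (induction u)
  case (Cons x u)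
  then show ?case
    using comp_inj_on[of "lam_word r u" "lists X" "lam_letter r x"]
      inj_on_subset[OF inj_on_lam_letter[of x], of "lam_word r u ` lists X"]
    by (auto simp: comp_def word_closed image_subset_iff)
qed (simp add: inj_on_def)

lemma inj_on_rho_letter: "w \<in> lists X \<Longrightarrow> inj_on (rho_letter r w) X"
proof (induction w)
  case (Cons y w)
  then have bij: "bij_betw (rho r y) X X" using sol by (simp add: yb_solution_def)
  show ?case
    using comp_inj_on[OF bij_betw_imp_inj_on[OF bij], of "rho_letter r w"] Cons
    by (simp add: comp_def bij_betw_imp_surj_on[OF bij])
qed (simp add: inj_on_def)

text \<open>Reading from the right: the bijection of \<open>X\<close> that \<open>\<rho>\<^sub>w\<close> applies to a letter of a word
  depends only on \<open>w\<close> and on the letters to the right of that letter.\<close>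

lemma inj_on_rho_word: "w \<in> lists X \<Longrightarrow> inj_on (rho_word r w) (lists X)"
proof (rule inj_onI)
  fix u v
  assume w: "w \<in> lists X"
  show "u \<in> lists X \<Longrightarrow> v \<in> lists X \<Longrightarrow> rho_word r w u = rho_word r w v \<Longrightarrow> u = v"
  proof (induction u arbitrary: v)
    case Nil
    then show ?case by (cases v) auto
  next
    case (Cons x u)
    obtain z v' where v: "v = z # v'" using Cons.prems(3) by (cases v) auto
    then have "u = v'" using Cons by simp
    then show ?case
      using inj_onD[OF inj_on_rho_letter[of "lam_word r u w"], of x z] Cons.prems v w
      by (simp add: word_closed)
  qed
qed

lemma r_inj:
  "x \<in> X \<Longrightarrow> y \<in> X \<Longrightarrow> x' \<in> X \<Longrightarrow> y' \<in> X \<Longrightarrow> lam r x y = lam r x' y' \<Longrightarrow> rho r y x = rho r y' x' \<Longrightarrow>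
    x = x' \<and> y = y'"
proof -
  assume xy: "x \<in> X" "y \<in> X" "x' \<in> X" "y' \<in> X"
    and eq: "lam r x y = lam r x' y'" "rho r y x = rho r y' x'"
  have "inj_on r (X \<times> X)" using sol by (simp add: yb_solution_def bij_betw_def)
  moreover have "r (x, y) = r (x', y')" using eq by (simp add: lam_def rho_def prod_eq_iff)
  ultimately show ?thesis using xy by (auto dest: inj_onD)
qed

text \<open>The extension moves letters of \<open>u\<close> past letters of \<open>v\<close> by successive applications of \<open>r\<close>, so
  these can be undone in reverse order.\<close>

lemma letter_word_inj:
  "x \<in> X \<Longrightarrow> x' \<in> X \<Longrightarrow> w \<in> lists X \<Longrightarrow> w' \<in> lists X \<Longrightarrow> lam_letter r x w = lam_letter r x' w' \<Longrightarrow>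
    rho_letter r w x = rho_letter r w' x' \<Longrightarrow> x = x' \<and> w = w'"
proof (induction w arbitrary: x x' w')
  case Nil
  then show ?case by (cases w') auto
next
  case (Cons y w)
  obtain y' v where v: "w' = y' # v" using Cons.prems(5) by (cases w') auto
  have "rho r y x = rho r y' x' \<and> w = v"
    using Cons.prems v by (intro Cons.IH) (auto simp: letter_closed)
  then show ?case
    using r_inj[of x y x' y'] Cons.prems v by auto
qed

lemma word_word_inj:
  "u \<in> lists X \<Longrightarrow> u' \<in> lists X \<Longrightarrow> v \<in> lists X \<Longrightarrow> v' \<in> lists X \<Longrightarrow> lam_word r u v = lam_word r u' v' \<Longrightarrow>
    rho_word r v u = rho_word r v' u' \<Longrightarrow> u = u' \<and> v = v'"
proof (induction u arbitrary: u')
  case Nil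
  then show ?case by (cases u') auto
next
  case (Cons x u)
  obtain x' t where t: "u' = x' # t" using Cons.prems(6) by (cases u') auto
  have "x = x' \<and> lam_word r u v = lam_word r t v'"
    using Cons.prems t by (intro letter_word_inj) (auto simp: word_closed)
  then show ?case
    using Cons t by auto
qed

subsection \<open>Finite sets of words closed under the extension\<close>

text \<open>The Yang--Baxter equation is inherited from words, and bijectivity follows from injectivity
  on words by finiteness. The classes of different words of \<open>K\<close> may coincide.\<close>

theorem subsolution_word_classes:
  assumes K: "K \<subseteq> lists X" "finite K" "K \<noteq> {}"
    and lamK: "\<And>u v. u \<in> K \<Longrightarrow> v \<in> K \<Longrightarrow> lam_word r u v \<in> K"
    and rhoK: "\<And>u v. u \<in> K \<Longrightarrow> v \<in> K \<Longrightarrow> rho_word r v u \<in> K"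
  shows "subsolution ((\<lambda>u. yb_cong X r `` {u}) ` K) (carrier (yb_monoid X r)) (yb_ext X r)"
proof -
  define c where "c u = yb_cong X r `` {u}" for u
  let ?Y = "c ` K" and ?R = "yb_ext X r"
  have R: "?R (c u, c v) = (c (lam_word r u v), c (rho_word r v u))" if "u \<in> K" "v \<in> K" for u v
    using yb_ext_class[OF sol, of u v] that K(1) unfolding c_def by blast
  have closed: "?R \<in> ?Y \<times> ?Y \<rightarrow> ?Y \<times> ?Y"
    using R lamK rhoK by fastforce
  have "yang_baxter ?Y ?R"
    unfolding yang_baxter_def
  proof
    fix t assume "t \<in> ?Y \<times> ?Y \<times> ?Y"
    then obtain u v w where uvw: "u \<in> K" "v \<in> K" "w \<in> K" "t = (c u, c v, c w)" by auto
    then have "u \<in> lists X" "v \<in> lists X" "w \<in> lists X" using K(1) by auto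
    from lam_word_lam_word[OF this] rho_word_rho_word[OF this] rho_lam_word[OF this]
    show "(yb12 ?R \<circ> yb23 ?R \<circ> yb12 ?R) t = (yb23 ?R \<circ> yb12 ?R \<circ> yb23 ?R) t"
      using uvw by (simp add: yb12_def yb23_def R lamK rhoK)
  qed
  then have yb: "yang_baxter ?Y (restrict ?R (?Y \<times> ?Y))"
    using closed by (intro yang_baxter_restrict)
  have bij_R: "bij_betw (restrict ?R (?Y \<times> ?Y)) (?Y \<times> ?Y) (?Y \<times> ?Y)"
  proof -
    have "bij_betw ?R (map_prod c c ` (K \<times> K)) (map_prod c c ` (K \<times> K))"
    proof (rule bij_betw_induced[where f = "\<lambda>(u, v). (lam_word r u v, rho_word r v u)"])
      show "inj_on (\<lambda>(u, v). (lam_word r u v, rho_word r v u)) (K \<times> K)"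
      proof (rule inj_onI, clarify)
        fix u v u' v'
        assume "u \<in> K" "v \<in> K" "u' \<in> K" "v' \<in> K"
          "lam_word r u v = lam_word r u' v'" "rho_word r v u = rho_word r v' u'"
        then show "u = u' \<and> v = v'"
          using K(1) by (intro word_word_inj) blast+
      qed
    qed (use K(2) lamK rhoK R in auto)
    moreover have "map_prod c c ` (K \<times> K) = ?Y \<times> ?Y"
      by (rule map_prod_surj_on) (rule HOL.refl)+
    ultimately have "bij_betw ?R (?Y \<times> ?Y) (?Y \<times> ?Y)" by simp
    then show ?thesis by (subst bij_betw_cong[where g = ?R]) auto
  qed
  have bij_lam: "bij_betw (lam (restrict ?R (?Y \<times> ?Y)) A) ?Y ?Y" if A: "A \<in> ?Y" for A
  proof -
    obtain u where u: "u \<in> K" "A = c u" using A by auto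
    then have "inj_on (lam_word r u) K"
      using K(1) by (blast intro: inj_on_subset[OF inj_on_lam_word])
    then show ?thesis
      by (rule bij_betw_induced[OF K(2)]) (use u lamK R in \<open>auto simp: lam_def\<close>)
  qed
  have bij_rho: "bij_betw (rho (restrict ?R (?Y \<times> ?Y)) A) ?Y ?Y" if A: "A \<in> ?Y" for A
  proof -
    obtain v where v: "v \<in> K" "A = c v" using A by auto
    then have "inj_on (rho_word r v) K"
      using K(1) by (blast intro: inj_on_subset[OF inj_on_rho_word])
    then show ?thesis
      by (rule bij_betw_induced[OF K(2)]) (use v rhoK R in \<open>auto simp: rho_def\<close>)
  qed
  have "?Y \<subseteq> carrier (yb_monoid X r)"
    using K(1) by (auto simp: c_def yb_monoid_def intro!: presented_class)
  then have "subsolution ?Y (carrier (yb_monoid X r)) ?R"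
    using closed yb bij_R bij_lam bij_rho K(2,3) by (simp add: subsolution_def yb_solution_def)
  then show ?thesis by (simp add: c_def)
qed

end

section \<open>Words representing multiples of generators\<close>

definition multiple_words :: "'a set \<Rightarrow> ('a \<times> 'a \<Rightarrow> 'a \<times> 'a) \<Rightarrow> nat \<Rightarrow> 'a list set"
  where "multiple_words X r k =
    {u \<in> lists X. length u = k \<and> successively (\<lambda>x y. lam r x y = x) u}"

context
  fixes X :: "'a set" and r :: "'a \<times> 'a \<Rightarrow> 'a \<times> 'a"
  assumes sol: "yb_solution X r"
begin

subsection \<open>Invariance under the extension\<close>

lemma successively_lam_letter:
  "a \<in> X \<Longrightarrow> u \<in> lists X \<Longrightarrow> successively (\<lambda>x y. lam r x y = x) u \<Longrightarrow>
    successively (\<lambda>x y. lam r x y = x) (lam_letter r a u)"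
proof (induction u arbitrary: a rule: induct_list012)
  case (3 x y u)
  then show ?case
    using yb_components(1)[OF sol, of a x y] by (auto simp: letter_closed[OF sol])
qed auto

lemma lam_word_multiple_words:
  assumes "u \<in> lists X" "v \<in> multiple_words X r k"
  shows "lam_word r u v \<in> multiple_words X r k"
proof -
  have v: "v \<in> lists X" "successively (\<lambda>x y. lam r x y = x) v"
    using assms(2) by (simp_all add: multiple_words_def)
  from assms(1) have "successively (\<lambda>x y. lam r x y = x) (lam_word r u v)"
    by (induction rule: lists.induct)
      (use v in \<open>simp_all add: successively_lam_letter lam_word_closed[OF sol]\<close>)
  then show ?thesis
    using assms by (simp add: multiple_words_def length_lam_word lam_word_closed[OF sol])
qed

text \<open>Here \<open>x\<close> and \<open>y\<close> are neighbouring letters of a word and \<open>w\<close> is what has already been moved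
  past everything to the right of \<open>y\<close>, so the letter \<open>x\<close> meets \<open>\<lambda>\<^sub>y(w)\<close> and \<open>y\<close> meets \<open>w\<close>.\<close>

lemma fixed_pair_rho_letter:
  "x \<in> X \<Longrightarrow> y \<in> X \<Longrightarrow> w \<in> lists X \<Longrightarrow> lam r x y = x \<Longrightarrow>
    lam r (rho_letter r (lam_letter r y w) x) (rho_letter r w y) = rho_letter r (lam_letter r y w) x"
proof (induction w arbitrary: x y)
  case (Cons z w)
  then have z: "z \<in> X" by simp
  \<comment> \<open>\<open>\<lambda>\<^sub>x \<lambda>\<^bsub>\<rho>\<^sub>y(x)\<^esub> = \<lambda>\<^sub>x \<lambda>\<^sub>y\<close> because \<open>\<lambda>\<^sub>x(y) = x\<close>, and \<open>\<lambda>\<^sub>x\<close> can be cancelled.\<close>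
  have "lam r (rho r y x) z = lam r y z"
    using yb_components(1)[OF sol Cons.prems(1,2) z] Cons.prems z
    by (auto intro!: inj_onD[OF bij_betw_imp_inj_on[OF lam_bij[OF sol, of x]]]
        simp: letter_closed[OF sol])
  then have "lam r (rho r (lam r y z) x) (rho r z y) = rho r (lam r y z) x"
    using yb_components(2)[OF sol Cons.prems(1,2) z] Cons.prems(4) by simp
  then show ?case
    using Cons by (simp add: letter_closed[OF sol])
qed simp

lemma rho_word_multiple_words:
  assumes "u \<in> multiple_words X r k" "w \<in> lists X"
  shows "rho_word r w u \<in> multiple_words X r k"
proof -
  have "u \<in> lists X" "successively (\<lambda>x y. lam r x y = x) u"
    using assms(1) by (simp_all add: multiple_words_def)
  then have "successively (\<lambda>x y. lam r x y = x) (rho_word r w u)"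
    by (induction u rule: induct_list012)
      (use assms(2) in \<open>simp_all add: fixed_pair_rho_letter lam_word_closed[OF sol]\<close>)
  then show ?thesis
    using assms by (simp add: multiple_words_def length_rho_word rho_word_closed[OF sol])
qed

subsection \<open>The cocycle of such a word\<close>

lemma constant_cocycle_iff_multiple_word:
  "x # u \<in> lists X \<Longrightarrow>
    cocycle_word r (x # u) = replicate (Suc (length u)) x \<longleftrightarrow>
    successively (\<lambda>x y. lam r x y = x) (x # u)"
proof (induction u arbitrary: x)
  case (Cons y u)
  then have xy: "x \<in> X" "y \<in> X" and yu: "y # u \<in> lists X" by simp_all
  have "cocycle_word r (x # y # u) = replicate (Suc (length (y # u))) x \<longleftrightarrow>
      map (lam r x) (cocycle_word r (y # u)) = replicate (Suc (length u)) x"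
    by (simp add: act_word_Cons)
  also have "\<dots> \<longleftrightarrow> lam r x y = x \<and>
      map (lam r x) (cocycle_word r (y # u)) = map (lam r x) (replicate (Suc (length u)) y)"
    by auto
  also have "\<dots> \<longleftrightarrow> lam r x y = x \<and> cocycle_word r (y # u) = replicate (Suc (length u)) y"
  proof -
    have "replicate (Suc (length u)) y \<in> lists X" using xy by (auto simp: in_lists_conv_set)
    then show ?thesis
      using act_word_inj[OF sol, of "[x]" "cocycle_word r (y # u)" "replicate (Suc (length u)) y"]
        cocycle_word_closed[OF sol yu] xy
      by (auto simp: act_word_Cons simp del: cocycle_word.simps replicate_Suc)
  qed
  also have "\<dots> \<longleftrightarrow> successively (\<lambda>x y. lam r x y = x) (x # y # u)"
    using Cons.IH[OF yu] by simp
  finally show ?case .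
qed simp

text \<open>The cocycle carries the sum \<open>k x\<close> in \<open>(M, +)\<close> to the class of the constant word
  \<open>x \<dots> x\<close> in the derived monoid, and it is injective.\<close>

lemma yb_gen_pow:
  assumes "u \<in> lists X" "x \<in> X" "cocycle_word r u = replicate k x"
  shows "yb_gen X r x [^]\<^bsub>yb_add_monoid X r\<^esub> k = yb_cong X r `` {u}"
  using assms(1,3)
proof (induction k arbitrary: u)
  case 0
  then have "u = []" by (cases u) auto
  then show ?case
    by (simp add: nat_pow_def yb_add_monoid_def yb_monoid_def presented_one)
next
  case (Suc k)
  have "replicate k x \<in> lists X" using assms(2) by (auto simp: in_lists_conv_set)
  then obtain v where v: "v \<in> lists X" "cocycle_word r v = replicate k x"
    by (rule cocycle_word_obtain[OF sol])
  have "yb_cocycle X r (yb_cong X r `` {v}) \<otimes>\<^bsub>derived_monoid X r\<^esub> yb_cocycle X r (yb_gen X r x)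
      = derived_cong X r `` {replicate k x @ [x]}"
    using v assms(2) cocycle_word_closed[OF sol v(1)]
    by (simp add: yb_cocycle_class[OF sol] yb_cocycle_gen[OF sol] derived_gen_def
        derived_monoid_def presented_mult)
  also have "\<dots> = yb_cocycle X r (yb_cong X r `` {u})"
    using Suc.prems by (simp add: yb_cocycle_class[OF sol] replicate_append_same)
  finally have "yb_gen X r x [^]\<^bsub>yb_add_monoid X r\<^esub> Suc k
      = inv_into (carrier (yb_monoid X r)) (yb_cocycle X r) (yb_cocycle X r (yb_cong X r `` {u}))"
    using Suc.IH[OF v] by (simp add: nat_pow_def yb_add_monoid_def)
  also have "\<dots> = yb_cong X r `` {u}"
    using Suc.prems(1) by (intro bij_betw_inv_into_left[OF yb_cocycle_bij[OF sol]])
      (simp add: yb_monoid_def presented_class)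
  finally show ?case .
qed

lemma yb_multiples_eq_classes:
  assumes "k > 0"
  shows "yb_multiples X r k = (\<lambda>u. yb_cong X r `` {u}) ` multiple_words X r k"
proof -
  have cocycle: "(\<exists>x \<in> X. cocycle_word r u = replicate k x) \<longleftrightarrow> u \<in> multiple_words X r k"
    if u: "u \<in> lists X" for u
  proof (cases u)
    case Nil
    then show ?thesis using assms by (auto simp: multiple_words_def)
  next
    case (Cons y v)
    have "(\<exists>x \<in> X. cocycle_word r u = replicate k x) \<longleftrightarrow>
        length u = k \<and> cocycle_word r u = replicate (length u) y"
    proof
      assume "\<exists>x \<in> X. cocycle_word r u = replicate k x"
      then obtain x where x: "cocycle_word r u = replicate k x" by blast
      from arg_cong[OF x, of length] have "length u = k"
        by (simp add: length_cocycle_word[OF sol])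
      with x Cons show "length u = k \<and> cocycle_word r u = replicate (length u) y" by auto
    qed (use u Cons in auto)
    also have "\<dots> \<longleftrightarrow> u \<in> multiple_words X r k"
      using constant_cocycle_iff_multiple_word[of y v] u Cons by (auto simp: multiple_words_def)
    finally show ?thesis .
  qed
  have "\<exists>u \<in> lists X. cocycle_word r u = replicate k x" if "x \<in> X" for x
    by (rule cocycle_word_obtain[OF sol, of "replicate k x"])
      (use that in \<open>auto simp: in_lists_conv_set\<close>)
  then have "yb_multiples X r k
      = (\<lambda>u. yb_cong X r `` {u}) ` {u \<in> lists X. \<exists>x \<in> X. cocycle_word r u = replicate k x}"
    unfolding yb_multiples_def using yb_gen_pow by (fastforce simp: image_iff)
  also have "{u \<in> lists X. \<exists>x \<in> X. cocycle_word r u = replicate k x} = multiple_words X r k"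
    using cocycle by (auto simp: multiple_words_def)
  finally show ?thesis .
qed

end

section \<open>Multiples of generators form a subsolution\<close>

theorem proposition4p2:
  fixes X :: "'a set" and r :: "'a \<times> 'a \<Rightarrow> 'a \<times> 'a" and k :: nat
  assumes "yb_solution X r" and "k > 0"
  shows "subsolution (yb_multiples X r k) (carrier (yb_monoid X r)) (yb_ext X r)"
proof -
  let ?K = "multiple_words X r k"
  have X: "finite X" "X \<noteq> {}" using assms(1) by (simp_all add: yb_solution_def)
  have lists: "?K \<subseteq> lists X" by (auto simp: multiple_words_def)
  have "?K \<subseteq> {u. set u \<subseteq> X \<and> length u = k}"
    by (auto simp: multiple_words_def)
  then have "finite ?K"
    using finite_lists_length_eq[OF X(1)] by (rule finite_subset)
  moreover have "?K \<noteq> {}"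
    using X(2) yb_multiples_eq_classes[OF assms] by (auto simp: yb_multiples_def)
  ultimately show ?thesis
    unfolding yb_multiples_eq_classes[OF assms]
    by (intro subsolution_word_classes[OF assms(1)] lists lam_word_multiple_words[OF assms(1)]
        rho_word_multiple_words[OF assms(1)] subsetD[OF lists])
qed

end
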